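(* There is an absolute constant $c>0$ such that for every $s\ge 2$, every system $I_1,\ldots,I_s\subset\mathbb{R}$ of pairwise disjoint closed segments and every $n\in\mathbb{N}$, $$E_n^*(I_1,\ldots,I_s)\le 2\exp(-c\,n\,\sigma/D),$$ where $\sigma$ is the minimum distance between the segments and $D$ is the diameter of their union. In fact, one can take $c=1/30$.
   Context: Let $I_1,\ldots,I_s$ be pairwise disjoint closed bounded intervals (segments) on the real line and $K:=I_1\sqcup\ldots\sqcup I_s$. Let $\mathcal{P}_n$ be the set of real algebraic polynomials of degree at most $n$, $\mathbf{1}_I$ the indicator function of $I$, $\operatorname{conv}K$ the convex hull of $K$, and $\|g\|_{C(S)}:=\max_{t\in S}|g(t)|$. For $f\in C(K)$ put $$E_n^*(f)_K:=\min\{\|f-P\|_{C(K)}: P\in\mathcal{P}_n,\ \|P\|_{C(\operatorname{conv}K)}\le\|f\|_{C(K)}\},$$ and define $$E_n^*(I_1,\ldots,I_s):=\max_{y_1,\ldots,y_s\in[-1,1]}E_n^*\Big(\sum_{i=1}^s y_i\mathbf{1}_{I_i}\Big)_K.$$ Further, $\sigma:=\min_{i\ne j}\min_{x\in I_i,\,y\in I_j}|x-y|$ and $D:=\operatorname{diam}(I_1\cup\ldots\cup I_s)$. *)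

theory Defs
  imports "HOL-Analysis.Analysis" "HOL-Computational_Algebra.Polynomial"
begin

(* The sup-norm on S.  It is only used for functions that are bounded and attain
   their maximum modulus on the nonempty set S (continuous functions on compact
   sets), where the supremum is a maximum. *)
definition sup_norm_on :: "real set \<Rightarrow> (real \<Rightarrow> real) \<Rightarrow> real" where
  "sup_norm_on S g = (SUP t\<in>S. \<bar>g t\<bar>)"

(* The set of competitors contains 0 and the errors are bounded below by 0.  For
   compact nonempty K and f continuous on K the infimum is a minimum, by
   compactness in the finite-dimensional space of polynomials. *)
definition constrained_approx_error :: "nat \<Rightarrow> real set \<Rightarrow> (real \<Rightarrow> real) \<Rightarrow> real" where
  "constrained_approx_error n K f =
     Inf {sup_norm_on K (\<lambda>t. f t - poly P t) | P :: real poly.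
            degree P \<le> n \<and> sup_norm_on (convex hull K) (poly P) \<le> sup_norm_on K f}"

definition segment_system :: "nat \<Rightarrow> (nat \<Rightarrow> real set) \<Rightarrow> bool" where
  "segment_system s I \<longleftrightarrow>
     (\<forall>i\<in>{1..s}. \<exists>a b. a \<le> b \<and> I i = {a..b}) \<and> disjoint_family_on I {1..s}"

definition segment_union :: "nat \<Rightarrow> (nat \<Rightarrow> real set) \<Rightarrow> real set" where
  "segment_union s I = (\<Union>i\<in>{1..s}. I i)"

(* For a segment system every value lies in [0, 1] (compare with P = 0), and it
   depends continuously on y, so the supremum is a maximum. *)
definition segment_approx_error :: "nat \<Rightarrow> nat \<Rightarrow> (nat \<Rightarrow> real set) \<Rightarrow> real" where
  "segment_approx_error n s I =
     (SUP y\<in>{1..s} \<rightarrow> {-1..1}.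
        constrained_approx_error n (segment_union s I)
          (\<lambda>t. \<Sum>i\<in>{1..s}. y i * indicat_real (I i) t))"

definition min_gap :: "nat \<Rightarrow> (nat \<Rightarrow> real set) \<Rightarrow> real" where
  "min_gap s I = Min {setdist (I i) (I j) | i j. i \<in> {1..s} \<and> j \<in> {1..s} \<and> i \<noteq> j}"

end

theory Submission
  imports Defs
begin

text \<open>
  The kernel \<open>(sin ((2l+1)\<theta>) / sin \<theta>)\<^sup>2\<^sup>k\<close> is a nonnegative even polynomial in \<open>x = sin \<theta>\<close>,
  of order \<open>(2l+1)\<^sup>2\<^sup>k\<close> for \<open>\<bar>x\<bar> \<le> 1/(2l+1)\<close> and at most \<open>\<bar>x\<bar>\<close> to the power \<open>-2k\<close> elsewhere.
  Its normalised antiderivative \<open>S\<close> is increasing from 0 to 1 on \<open>[-1, 1]\<close>; if \<open>k\<close> is proportional to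
  \<open>n\<delta>\<close> and \<open>l\<close> to \<open>1/\<delta>\<close>, then \<open>S\<close> is exponentially close in \<open>n\<delta>\<close> to a step outside \<open>[-\<delta>, \<delta>]\<close>.

  Differences of two translates of \<open>S\<close>, rescaled to the diameter of the set, are nearly indicator
  functions of the segments \<open>[a\<^sub>i, b\<^sub>i]\<close>. When the jumps are placed \<open>\<sigma>/2\<close> outside the
  segments, monotonicity of \<open>S\<close> makes these differences nonnegative with sum at most 1 on the whole
  convex hull, so combining them with the coefficients \<open>y\<^sub>i\<close> gives the required polynomial
  without increasing the norm.
\<close>

section \<open>Polynomial antiderivatives and a linear lower bound for sine\<close>

lemma poly_antiderivative:
  fixes q :: "'a :: field_char_0 poly"
  obtains Q where "pderiv Q = q" "degree Q \<le> Suc (degree q)"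
proof
  define Q where "Q = (\<Sum>i\<le>degree q. monom (coeff q i / of_nat (Suc i)) (Suc i))"
  have "pderiv Q = (\<Sum>i\<le>degree q. monom (coeff q i) i)"
    unfolding Q_def higher_pderiv_sum[of 1, simplified] pderiv_monom
    by (intro sum.cong refl) (simp del: of_nat_Suc)
  then show "pderiv Q = q"
    by (simp add: poly_as_sum_of_monoms)
  show "degree Q \<le> Suc (degree q)"
    unfolding Q_def
    by (intro degree_sum_le) (auto intro: order.trans[OF degree_monom_le])
qed

text \<open>The cubic Taylor remainder is at most \<open>x / 6\<close> on the unit interval. The
  factors 5/6 in the kernel bounds come from here.\<close>

lemma sin_ge_linear:
  fixes x :: real
  assumes "0 \<le> x" "x \<le> 1"
  shows "5 / 6 * x \<le> sin x"
proof -
  have "(\<Sum>m<3. sin_coeff m * x ^ m) = x"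
    by (simp add: eval_nat_numeral sin_coeff_def)
  moreover have "fact 3 = (6::real)"
    by (simp add: fact_numeral)
  ultimately have "\<bar>sin x - x\<bar> \<le> \<bar>x\<bar> ^ 3 / 6"
    using Maclaurin_sin_bound[of x 3] by (simp add: field_simps)
  moreover have "x ^ 3 \<le> x ^ 1"
    using assms by (intro power_decreasing) auto
  ultimately show ?thesis
    using assms unfolding power_one_right abs_of_nonneg[OF assms(1)] by linarith
qed

section \<open>The Dirichlet kernel as a polynomial in the sine\<close>

text \<open>This is sin ((2l+1)t) / sin t in the variable x = sin t, i.e. the Chebyshev polynomial
  of degree 2l+1 divided by x, up to sign. The recurrence encodes sin (u+2t) + sin (u-2t) = 2 cos
  (2t) sin u with cos (2t) = 1 - 2 (sin t)^2, so no division is involved at x = 0.\<close>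

fun sin_dirichlet :: "nat \<Rightarrow> real poly" where
  "sin_dirichlet 0 = 1"
| "sin_dirichlet (Suc 0) = [:3, 0, -4:]"
| "sin_dirichlet (Suc (Suc l)) = [:2, 0, -4:] * sin_dirichlet (Suc l) - sin_dirichlet l"

lemma degree_sin_dirichlet: "degree (sin_dirichlet l) \<le> 2 * l"
proof (induction l rule: sin_dirichlet.induct)
  case (3 l)
  have "degree ([:2, 0, -4:] * sin_dirichlet (Suc l)) \<le> 2 + 2 * Suc l"
    using "3.IH"(1) by (intro order.trans[OF degree_mult_le] add_mono) auto
  then show ?case
    using "3.IH"(2) by (auto intro!: degree_diff_le)
qed auto

lemma poly_sin_dirichlet_minus: "poly (sin_dirichlet l) (- x) = poly (sin_dirichlet l) x"
  by (induction l rule: sin_dirichlet.induct) auto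

lemma poly_sin_dirichlet_0: "poly (sin_dirichlet l) 0 = 2 * real l + 1"
  by (induction l rule: sin_dirichlet.induct) auto

lemma poly_sin_dirichlet_sin:
  "poly (sin_dirichlet l) (sin t) * sin t = sin ((2 * real l + 1) * t)"
proof (induction l rule: sin_dirichlet.induct)
  case 2
  have "sin (3 * t) = sin (2 * t + t)"
    by simp
  also have "\<dots> = 2 * sin t * (cos t)\<^sup>2 + (1 - 2 * (sin t)\<^sup>2) * sin t"
    unfolding sin_add by (simp add: sin_double cos_double_sin power2_eq_square)
  also have "\<dots> = poly (sin_dirichlet (Suc 0)) (sin t) * sin t"
    unfolding cos_squared_eq by (simp add: algebra_simps power2_eq_square)
  finally show ?case
    by simp
next
  case (3 l)
  define u where "u = (2 * real (Suc l) + 1) * t"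
  have u: "(2 * real (Suc (Suc l)) + 1) * t = u + 2 * t" "(2 * real l + 1) * t = u - 2 * t"
    by (auto simp: u_def algebra_simps)
  have "poly (sin_dirichlet (Suc (Suc l))) (sin t) * sin t
      = 2 * (1 - 2 * (sin t)\<^sup>2) * (poly (sin_dirichlet (Suc l)) (sin t) * sin t)
        - poly (sin_dirichlet l) (sin t) * sin t"
    by (simp add: algebra_simps power2_eq_square)
  also have "\<dots> = 2 * cos (2 * t) * sin u - sin (u - 2 * t)"
    using "3.IH" u by (simp add: cos_double_sin u_def)
  also have "\<dots> = sin (u + 2 * t)"
    by (simp add: sin_add sin_diff)
  finally show ?case
    using u by simp
qed auto

text \<open>Multiplied by x = sin t, the kernel becomes a sine.\<close>

lemma sin_dirichlet_upper:
  assumes "0 < x" "x \<le> 1"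
  shows "\<bar>poly (sin_dirichlet l) x\<bar> \<le> 1 / x"
proof -
  have "\<bar>poly (sin_dirichlet l) x * x\<bar> \<le> 1"
    using poly_sin_dirichlet_sin[of l "arcsin x"] assms by simp
  then show ?thesis
    using assms by (simp add: abs_mult field_simps)
qed

text \<open>For positive x = sin t, the range of \<open>x\<close> keeps \<open>m\<close> t in
  [0, 1], where sin (\<open>m\<close> t) is at least 5/6 \<open>m\<close> t, and t is at least x.
  Evenness and the value at 0 cover the other cases.\<close>

lemma sin_dirichlet_lower:
  fixes l :: nat
  defines "m \<equiv> 2 * real l + 1"
  assumes "\<bar>x\<bar> \<le> 5 / (6 * m)"
  shows "5 / 6 * m \<le> poly (sin_dirichlet l) x"
proof -
  have m: "m \<ge> 1"
    by (simp add: m_def)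
  have pos: "5 / 6 * m \<le> poly (sin_dirichlet l) x" if x: "0 < x" "x \<le> 5 / (6 * m)" for x
  proof -
    \<comment> \<open>The radius 5/(6m) is chosen to lie below sin (1/m), so that arcsin x is at
      most 1/m.\<close>
    have "5 / 6 * (1 / m) \<le> sin (1 / m)"
      using m by (intro sin_ge_linear) auto
    then have xs: "x \<le> sin (1 / m)"
      using x by simp
    have "arcsin x \<le> arcsin (sin (1 / m))"
      using xs x(1) by (intro arcsin_le_arcsin) auto
    moreover have "1 / m \<le> pi / 2"
      using m pi_ge_two mult_mono[of 2 pi 1 m] by (simp add: field_simps)
    ultimately have t: "arcsin x \<le> 1 / m"
      using m pi_gt_zero by (subst (asm) arcsin_sin) (auto simp: field_simps)
    have x1: "x \<le> 1"
      using xs sin_le_one order.trans by blast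
    have t0: "0 \<le> arcsin x"
      using arcsin_le_arcsin[of 0 x] x(1) x1 by simp
    have sx: "sin (arcsin x) = x"
      using x(1) x1 by simp
    have "m * x \<le> m * arcsin x"
      using m sin_x_le_x[OF t0] sx by (intro mult_left_mono) auto
    then have "5 / 6 * m * x \<le> 5 / 6 * (m * arcsin x)"
      by simp
    also have "\<dots> \<le> sin (m * arcsin x)"
      using t t0 m by (intro sin_ge_linear) (auto simp: field_simps)
    also have "\<dots> = poly (sin_dirichlet l) x * x"
      using poly_sin_dirichlet_sin[of l "arcsin x"] sx by (simp add: m_def)
    finally show ?thesis
      using x by simp
  qed
  consider "x > 0" | "x = 0" | "x < 0"
    by linarith
  then show ?thesis
  proof cases
    case 1
    then show ?thesis using pos assms by simp
  next
    case 2
    then show ?thesis using m by (simp add: poly_sin_dirichlet_0 m_def)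
  next
    case 3
    then show ?thesis using pos[of "- x"] assms by (simp add: poly_sin_dirichlet_minus)
  qed
qed

section \<open>The smoothed step polynomial\<close>

text \<open>
  The bound \<open>\<epsilon>\<close> is half of the kernel's one-sided tail bound, \<open>inverse \<delta> ^ (2 * k - 1) / (2 * k - 1)\<close>,
  divided by the lower bound \<open>h * (5 / 6 * m) ^ (2 * k)\<close>, \<open>h = 5 / (6 * m)\<close>, for its mass on \<open>[0, 1]\<close>.
\<close>
lemma step_polynomial_exists:
  fixes k l :: nat and \<delta> :: real
  defines "m \<equiv> 2 * real l + 1"
  assumes k: "k > 0" and \<delta>: "0 < \<delta>" "\<delta> \<le> 1"
  defines "\<epsilon> \<equiv> 18 / (25 * (2 * real k - 1)) * (6 / (5 * (m * \<delta>))) ^ (2 * k - 1)"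
  obtains S :: "real poly" where "degree S \<le> 4 * k * l + 1"
    "mono_on {-1..1} (poly S)" "poly S (-1) = 0" "poly S 1 = 1"
    "poly S (-\<delta>) \<le> \<epsilon>" "1 - \<epsilon> \<le> poly S \<delta>"
proof -
  define q where "q = sin_dirichlet l ^ (2 * k)"
  obtain Q0 where Q0: "pderiv Q0 = q" "degree Q0 \<le> Suc (degree q)"
    by (rule poly_antiderivative)
  \<comment> \<open>Vanishing at 0 makes the antiderivative of the even kernel odd, so the two tails
    are mirror images.\<close>
  define Q where "Q = Q0 - [:poly Q0 0:]"
  have Q: "pderiv Q = q" "poly Q 0 = 0"
    using Q0 by (simp_all add: Q_def pderiv_diff)
  have DQ: "(poly Q has_real_derivative poly q x) (at x)" for x
    using poly_DERIV[of Q x] Q by simp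
  have q0: "0 \<le> poly q x" for x
    unfolding q_def poly_power by (simp add: zero_le_even_power)
  have m: "m \<ge> 1"
    by (simp add: m_def)
  have monoQ: "poly Q x \<le> poly Q y" if "x \<le> y" for x y
    by (rule DERIV_nonneg_imp_nondecreasing[OF that]) (use DQ q0 in blast)
  have "poly Q x + poly Q (- x) = poly Q 0 + poly Q (- 0)" for x
  proof (rule DERIV_isconst_all[of "\<lambda>x. poly Q x + poly Q (- x)"], rule allI)
    fix x
    have "((\<lambda>x. poly Q (- x)) has_real_derivative poly q (- x) * (-1)) (at x)"
      by (rule DERIV_chain2[OF DQ]) (auto intro!: derivative_eq_intros)
    then have "((\<lambda>x. poly Q x + poly Q (- x)) has_real_derivative poly q x + poly q (- x) * (-1)) (at x)"
      by (intro DERIV_add DQ)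
    then show "((\<lambda>x. poly Q x + poly Q (- x)) has_real_derivative 0) (at x)"
      by (simp add: q_def poly_power poly_sin_dirichlet_minus)
  qed
  then have odd: "poly Q (- x) = - poly Q x" for x
    using Q(2) by (smt (verit))
  define h where "h = 5 / (6 * m)"
  have h: "0 < h" "h \<le> 1"
    using m by (auto simp: h_def field_simps)
  \<comment> \<open>The mean value theorem replaces integration: the mass on [0, h] is at least h
    times the lower bound of the kernel there.\<close>
  have "\<exists>z. 0 < z \<and> z < h \<and> poly Q h - poly Q 0 = (h - 0) * poly q z"
    using h DQ by (intro MVT2) auto
  then obtain z where z: "0 < z" "z < h" "poly Q h = h * poly q z"
    using Q(2) by auto
  have "(5 / 6 * m) ^ (2 * k) \<le> poly q z"
    unfolding q_def poly_power using z m
    by (intro power_mono sin_dirichlet_lower[of _ l, folded m_def]) (auto simp: h_def)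
  then have "h * (5 / 6 * m) ^ (2 * k) \<le> poly Q 1"
    using z h monoQ[of h 1] by (smt (verit) mult_left_mono)
  \<comment> \<open>One factor is absorbed by h, since h * (5/6 m) = 25/36; the remaining exponent
    matches that of the tail.\<close>
  moreover have "h * (5 / 6 * m) ^ (2 * k) = 25 / 36 * (5 / 6 * m) ^ (2 * k - 1)"
  proof -
    obtain j where "2 * k = Suc j"
      using k by (cases "2 * k") auto
    then show ?thesis
      using m by (simp add: h_def field_simps)
  qed
  ultimately have Q1: "25 / 36 * (5 / 6 * m) ^ (2 * k - 1) \<le> poly Q 1"
    by simp
  then have Q1pos: "0 < poly Q 1"
    using m by (smt (verit) zero_less_power divide_pos_pos mult_pos_pos)

  define p where "p = 2 * k - 1"
  have p: "2 * k = Suc p" "p > 0" "real p = 2 * real k - 1"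
    using k by (auto simp: p_def of_nat_diff)
  \<comment> \<open>Adding an antiderivative of -x^(-2k) turns the pointwise bound q(x) \<le>
    x^(-2k) into monotonicity, which bounds the mass on [\<delta>, 1].\<close>
  have "poly Q 1 + inverse 1 ^ p / real p \<le> poly Q \<delta> + inverse \<delta> ^ p / real p"
  proof (rule DERIV_nonpos_imp_nonincreasing[OF \<delta>(2)])
    fix x assume x: "\<delta> \<le> x" "x \<le> 1"
    then have x0: "0 < x"
      using \<delta> by simp
    obtain j where j: "p = Suc j"
      using p by (cases p) auto
    have "((\<lambda>x. inverse x ^ Suc j) has_real_derivative real (Suc j) * - (inverse x ^ Suc (Suc j))) (at x)"
      using DERIV_power_Suc[OF DERIV_inverse, of x j UNIV] x0 by (simp add: ac_simps)
    then have "((\<lambda>x. poly Q x + inverse x ^ p / real p) has_real_derivative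
        poly q x + real p * - (inverse x ^ Suc p) / real p) (at x)"
      unfolding j by (intro DERIV_add DQ DERIV_cdivide)
    then have "((\<lambda>x. poly Q x + inverse x ^ p / real p) has_real_derivative
        poly q x - inverse x ^ Suc p) (at x)"
      using p(2) by simp
    moreover have "poly q x = \<bar>poly (sin_dirichlet l) x\<bar> ^ (2 * k)"
      by (simp add: q_def poly_power power_even_abs)
    then have "poly q x \<le> inverse x ^ (Suc p)"
      using sin_dirichlet_upper[of x l] x x0 p(1)
      by (metis abs_ge_zero inverse_eq_divide power_mono)
    ultimately show "\<exists>y. ((\<lambda>x. poly Q x + inverse x ^ p / real p) has_real_derivative y) (at x) \<and> y \<le> 0"
      by (intro exI conjI) auto
  qed
  moreover have "0 \<le> inverse 1 ^ p / real p"
    by simp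
  ultimately have "poly Q 1 - poly Q \<delta> \<le> inverse \<delta> ^ p / real p"
    by linarith
  also have "\<dots> = 2 * \<epsilon> * (25 / 36 * (5 / 6 * m) ^ p)"
    using m \<delta> p(2) unfolding \<epsilon>_def p(3)[symmetric] p_def[symmetric]
    by (simp add: field_simps power_mult_distrib power_divide)
  also have "\<dots> \<le> 2 * \<epsilon> * poly Q 1"
    using Q1 m \<delta> p(2) unfolding \<epsilon>_def p(3)[symmetric] p_def[symmetric]
    by (intro mult_left_mono) auto
  finally have tail: "poly Q 1 - poly Q \<delta> \<le> 2 * \<epsilon> * poly Q 1" .

  \<comment> \<open>Since Q is odd, this scaling sends -1 to 0 and 1 to 1, and it halves the
    relative tail 2 \<epsilon>.\<close>
  define S where "S = [:1 / 2:] + smult (1 / (2 * poly Q 1)) Q"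
  have S: "poly S x = 1 / 2 + poly Q x / (2 * poly Q 1)" for x
    by (simp add: S_def)
  have "degree q \<le> 4 * k * l"
    using degree_power_le[of "sin_dirichlet l" "2 * k"] degree_sin_dirichlet[of l]
    unfolding q_def by (smt (verit) mult.assoc mult.commute mult_le_mono1 mult_2 numeral_Bit0
        order.trans add_mult_distrib)
  then have "degree S \<le> 4 * k * l + 1"
    using Q0(2) unfolding S_def Q_def
    by (intro degree_add_le order.trans[OF degree_smult_le] degree_diff_le) auto
  moreover have "mono_on {-1..1} (poly S)"
    using Q1pos monoQ by (intro mono_onI) (simp add: S divide_right_mono)
  moreover have "poly S (-1) = 0" "poly S 1 = 1"
    using Q1pos odd[of 1] by (simp_all add: S)
  moreover have "poly S (-\<delta>) \<le> \<epsilon>" "1 - \<epsilon> \<le> poly S \<delta>"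
    using Q1pos tail odd[of \<delta>] by (simp_all add: S field_simps)
  ultimately show ?thesis
    using that by blast
qed

section \<open>Choice of parameters for exponential decay\<close>

text \<open>The base is at most 3/5, so the error is of order (9/25)^k. This leaves room to pass to
  (2/3)^(k+1), and 2/3 \<le> exp (-1/3) yields the rate 1/15.\<close>

lemma step_polynomial_error_le:
  fixes k :: nat and r N :: real
  assumes k: "2 \<le> k" and N: "N \<le> 5 * (real k + 1)" and r: "2 \<le> r"
  shows "18 / (25 * (2 * real k - 1)) * (6 / (5 * r)) ^ (2 * k - 1) \<le> exp (- N / 15) / 2"
proof -
  have "(6 / (5 * r)) ^ (2 * k - 1) \<le> (3 / 5) ^ (2 * k - 1)"
    using r by (intro power_mono) (auto simp: field_simps)
  moreover have "18 / (25 * (2 * real k - 1)) \<le> 6 / 25"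
    using k by (simp add: field_simps)
  ultimately have "18 / (25 * (2 * real k - 1)) * (6 / (5 * r)) ^ (2 * k - 1)
      \<le> 6 / 25 * (3 / 5) ^ (2 * k - 1)"
    using r by (intro mult_mono) auto
  also have "(3 / 5 :: real) ^ (2 * k - 1) = 5 / 3 * (9 / 25) ^ k"
  proof -
    have "(9 / 25 :: real) ^ k = (3 / 5) ^ (2 * k)"
      by (simp add: power_mult power2_eq_square)
    also have "2 * k = Suc (2 * k - 1)"
      using k by simp
    finally show ?thesis
      by simp
  qed
  also have "6 / 25 * (5 / 3 * (9 / 25) ^ k) \<le> (2 / 3) ^ Suc k / (2::real)"
  proof -
    have "(9 / 25 :: real) ^ k = (27 / 50) ^ k * (2 / 3) ^ k"
      by (simp flip: power_mult_distrib)
    moreover have "(27 / 50 :: real) ^ k \<le> (27 / 50) ^ 1"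
      using k by (intro power_decreasing) auto
    ultimately have "(9 / 25 :: real) ^ k \<le> 27 / 50 * (2 / 3) ^ k"
      by (simp add: mult_right_mono)
    moreover have "0 \<le> (2 / 3 :: real) ^ k"
      by simp
    ultimately show ?thesis
      unfolding power_Suc by linarith
  qed
  also have "(2 / 3 :: real) ^ Suc k \<le> exp (- 1 / 3) ^ Suc k"
    using exp_ge_add_one_self[of "- 1 / 3"] by (intro power_mono) auto
  also have "exp (- 1 / 3 :: real) ^ Suc k = exp (real (Suc k) * (- 1 / 3))"
    by (rule exp_of_nat_mult[symmetric])
  also have "\<dots> \<le> exp (- N / 15)"
    using N by simp
  finally show ?thesis
    by simp
qed

text \<open>The degree budget is split so that \<open>k\<close> is about n\<delta>/5, which gives
  the decay rate, while (2l+1)\<delta> stays at least 2, which keeps the base below 1.\<close>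

lemma exponential_step_polynomial:
  fixes n :: nat and \<delta> :: real
  assumes \<delta>: "0 < \<delta>" "\<delta> \<le> 1 / 2" and n: "10 \<le> real n * \<delta>"
  obtains S :: "real poly" where "degree S \<le> n"
    "mono_on {-1..1} (poly S)" "poly S (-1) = 0" "poly S 1 = 1"
    "poly S (-\<delta>) \<le> exp (- (real n * \<delta>) / 15) / 2"
    "1 - exp (- (real n * \<delta>) / 15) / 2 \<le> poly S \<delta>"
proof -
  define k where "k = nat \<lfloor>real n * \<delta> / 5\<rfloor>"
  have k: "2 \<le> k" "5 * real k \<le> real n * \<delta>" "real n * \<delta> \<le> 5 * (real k + 1)"
  proof -
    have "2 \<le> \<lfloor>real n * \<delta> / 5\<rfloor>"
      using n by (simp add: le_floor_iff)
    then have "real k = of_int \<lfloor>real n * \<delta> / 5\<rfloor>" "2 \<le> k"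
      unfolding k_def by linarith+
    moreover have "real n * \<delta> / 5 \<le> of_int \<lfloor>real n * \<delta> / 5\<rfloor> + 1"
        "of_int \<lfloor>real n * \<delta> / 5\<rfloor> \<le> real n * \<delta> / 5"
      by linarith+
    ultimately show "2 \<le> k" "5 * real k \<le> real n * \<delta>" "real n * \<delta> \<le> 5 * (real k + 1)"
      by argo+
  qed
  \<comment> \<open>The largest \<open>l\<close> for which the degree bound 4kl + 1 does not exceed
    n.\<close>
  define l where "l = (n - 1) div (4 * k)"
  define r where "r = (2 * real l + 1) * \<delta>"
  have n0: "n > 0"
    using n by (cases n) auto
  have "4 * k * l \<le> n - 1"
    unfolding l_def by simp
  then have deg: "4 * k * l + 1 \<le> n"
    using n0 by linarith
  have "n - 1 < 4 * k * (l + 1)"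
    using k(1) dividend_less_times_div[of "4 * k" "n - 1"] by (simp add: l_def)
  then have "n \<le> 4 * k * (l + 1)"
    by linarith
  then have "real n \<le> real (4 * k * (l + 1))"
    by (rule of_nat_mono)
  \<comment> \<open>Maximality of \<open>l\<close> gives 5k \<le> n\<delta> \<le> 2kr + k, hence r
    \<ge> 2.\<close>
  then have "real n * \<delta> \<le> real (4 * k * (l + 1)) * \<delta>"
    using \<delta> by (intro mult_right_mono) auto
  also have "\<dots> = 2 * real k * r + 2 * real k * \<delta>"
    by (simp add: r_def algebra_simps)
  also have "\<dots> \<le> 2 * real k * r + 2 * real k * (1 / 2)"
    using \<delta> by (intro add_left_mono mult_left_mono) auto
  finally have "real k * 4 \<le> real k * (2 * r)"
    using k(2) by linarith
  then have r: "2 \<le> r"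
    using k(1) by (subst (asm) mult_le_cancel_left_pos) auto
  note err = step_polynomial_error_le[OF k(1) k(3) r]
  obtain S :: "real poly" where S: "degree S \<le> 4 * k * l + 1"
    "mono_on {-1..1} (poly S)" "poly S (-1) = 0" "poly S 1 = 1"
    "poly S (-\<delta>) \<le> 18 / (25 * (2 * real k - 1)) * (6 / (5 * r)) ^ (2 * k - 1)"
    "1 - 18 / (25 * (2 * real k - 1)) * (6 / (5 * r)) ^ (2 * k - 1) \<le> poly S \<delta>"
    using k(1) \<delta> unfolding r_def by (elim step_polynomial_exists[rotated 3]) auto
  show ?thesis
    by (rule that[of S]) (use S err deg in \<open>auto simp: algebra_simps\<close>)
qed

section \<open>Total weight of ordered increments, and the use of competitors\<close>

text \<open>A telescoping bound: as \<open>a\<close> grows, the increments from \<open>R i\<close>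
  to \<open>L i\<close> occupy successively lower parts of [z, 1].\<close>

lemma sum_disjoint_increments_le:
  fixes a L R :: "'a \<Rightarrow> real"
  assumes "finite A" "inj_on a A"
    and "\<And>i j. i \<in> A \<Longrightarrow> j \<in> A \<Longrightarrow> a i < a j \<Longrightarrow> L j \<le> R i"
    and "\<And>i. i \<in> A \<Longrightarrow> L i \<le> 1" "\<And>i. i \<in> A \<Longrightarrow> z \<le> R i" "z \<le> 1"
  shows "(\<Sum>i\<in>A. L i - R i) \<le> 1 - z"
  using assms
proof (induction A arbitrary: z rule: finite_ranking_induct[where f = a])
  case (insert x A)
  show ?case
  proof (cases "x \<in> A")
    case True
    then show ?thesis
      using insert.IH[of z] insert.prems by (metis insert_absorb)
  next
    case False
    \<comment> \<open>The index \<open>x\<close> has the largest \<open>a\<close>, so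
      \<open>L x\<close> serves as the floor for all the others.\<close>
    have "(\<Sum>i\<in>A. L i - R i) \<le> 1 - L x"
    proof (rule insert.IH)
      fix i assume i: "i \<in> A"
      then have "a i \<noteq> a x"
        using inj_onD[OF insert.prems(1), of i x] False by blast
      then have "a i < a x"
        using insert.hyps(2)[OF i] by simp
      then show "L x \<le> R i"
        using insert.prems(2)[of i x] i by blast
    next
      show "inj_on a A"
        using insert.prems(1) by (rule inj_on_subset) blast
    qed (blast intro: insert.prems)+
    moreover have "z \<le> R x"
      by (blast intro: insert.prems)
    ultimately show ?thesis
      using False insert.hyps(1) by simp
  qed
qed simp

lemma constrained_approx_error_le:
  assumes K: "compact K" "K \<noteq> {}" and f: "bounded (f ` K)"
    and "degree P \<le> n" "\<And>x. x \<in> convex hull K \<Longrightarrow> \<bar>poly P x\<bar> \<le> sup_norm_on K f"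
    and "\<And>x. x \<in> K \<Longrightarrow> \<bar>f x - poly P x\<bar> \<le> e"
  shows "constrained_approx_error n K f \<le> e"
proof -
  \<comment> \<open>A real \<open>Inf\<close> is bounded by its members only if the set is bounded
    below, and \<open>SUP\<close> behaves as a supremum only for bounded functions.\<close>
  have nonneg: "0 \<le> sup_norm_on K (\<lambda>t. f t - poly Q t)" for Q
  proof -
    have "bounded (poly Q ` K)"
      using K by (intro compact_imp_bounded compact_continuous_image continuous_intros)
    then have "bdd_above ((\<lambda>t. \<bar>f t - poly Q t\<bar>) ` K)"
      using bounded_minus_comp[of f K "poly Q"] f by (force simp: bounded_iff bdd_above_def)
    then show ?thesis
      unfolding sup_norm_on_def using K(2) by (auto intro: cSUP_upper2)
  qed
  have "sup_norm_on (convex hull K) (poly P) \<le> sup_norm_on K f"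
    using K(2) assms(5) unfolding sup_norm_on_def[of "convex hull K"] by (intro cSUP_least) auto
  then have "constrained_approx_error n K f \<le> sup_norm_on K (\<lambda>t. f t - poly P t)"
    unfolding constrained_approx_error_def using nonneg assms(4)
    by (intro cInf_lower) (auto intro!: bdd_belowI[of _ 0])
  also have "\<dots> \<le> e"
    unfolding sup_norm_on_def using K(2) assms(6) by (intro cSUP_least) auto
  finally show ?thesis .
qed

section \<open>Construction of the approximating polynomial for fixed values on the segments\<close>

lemma constrained_approx_error_step_le:
  fixes y :: "nat \<Rightarrow> real"
  assumes s: "s \<ge> 2" and I: "segment_system s I" and y: "y \<in> {1..s} \<rightarrow> {-1..1}"
  shows "constrained_approx_error n (segment_union s I) (\<lambda>t. \<Sum>i\<in>{1..s}. y i * indicat_real (I i) t)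
    \<le> 2 * exp (- (real n * min_gap s I / diameter (segment_union s I)) / 30)"
proof -
  define K where "K = segment_union s I"
  define f where "f = (\<lambda>t. \<Sum>i\<in>{1..s}. y i * indicat_real (I i) t)"
  define \<sigma> where "\<sigma> = min_gap s I"
  define D where "D = diameter K"
  have "\<forall>i\<in>{1..s}. \<exists>ab. fst ab \<le> snd ab \<and> I i = {fst ab..snd ab}"
    using I by (force simp: segment_system_def)
  then obtain ab where "\<forall>i\<in>{1..s}. fst (ab i) \<le> snd (ab i) \<and> I i = {fst (ab i)..snd (ab i)}"
    by metis
  then obtain a b where ab: "\<And>i. i \<in> {1..s} \<Longrightarrow> a i \<le> b i" "\<And>i. i \<in> {1..s} \<Longrightarrow> I i = {a i..b i}"
    using that[of "fst \<circ> ab" "snd \<circ> ab"] by auto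
  have disj: "I i \<inter> I j = {}" if "i \<in> {1..s}" "j \<in> {1..s}" "i \<noteq> j" for i j
    using I that unfolding segment_system_def disjoint_family_on_def by blast
  have one: "1 \<in> {1..s}" "2 \<in> {1..s}"
    using s by auto
  have compact: "compact K"
    unfolding K_def segment_union_def using ab(2) by (intro compact_UN) auto
  have inK: "a i \<in> K" "b i \<in> K" if "i \<in> {1..s}" for i
    using ab[OF that] that by (force simp: K_def segment_union_def)+
  have nonempty: "K \<noteq> {}"
    using inK one by blast
  obtain A where A: "A \<in> K" "\<And>x. x \<in> K \<Longrightarrow> A \<le> x"
    using compact_attains_inf[OF compact nonempty] by blast
  obtain B where B: "B \<in> K" "\<And>x. x \<in> K \<Longrightarrow> x \<le> B"
    using compact_attains_sup[OF compact nonempty] by blast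
  have dist_le: "\<bar>x - t\<bar> \<le> D" if "x \<in> K" "t \<in> K" for x t
    using diameter_bounded_bound[OF compact_imp_bounded[OF compact] that] by (simp add: D_def dist_real_def)
  have AB: "B - A \<le> D"
    using dist_le[OF B(1) A(1)] by linarith
  have hull: "convex hull K \<subseteq> {A..B}"
    using A(2) B(2) by (intro hull_minimal) auto
  have \<sigma>_le: "\<sigma> \<le> setdist (I i) (I j)" if "i \<in> {1..s}" "j \<in> {1..s}" "i \<noteq> j" for i j
  proof -
    have "finite ((\<lambda>(i, j). setdist (I i) (I j)) ` ({1..s} \<times> {1..s}))"
      by blast
    then have "finite {setdist (I i) (I j) | i j. i \<in> {1..s} \<and> j \<in> {1..s} \<and> i \<noteq> j}"
      by (rule rev_finite_subset) auto
    then show ?thesis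
      unfolding \<sigma>_def min_gap_def using that by (intro Min_le) auto
  qed
  have \<sigma>_dist: "\<sigma> \<le> \<bar>u - v\<bar>" if "i \<in> {1..s}" "j \<in> {1..s}" "i \<noteq> j" "u \<in> I i" "v \<in> I j" for i j u v
    using order.trans[OF \<sigma>_le setdist_le_dist] that by (metis dist_real_def)
  have gap: "b i + \<sigma> \<le> a j" if "i \<in> {1..s}" "j \<in> {1..s}" "a i < a j" for i j
  proof -
    have ne: "i \<noteq> j"
      using that by auto
    have "a j \<notin> I i"
      using disj[OF that(1,2) ne] ab[OF that(2)] by auto
    then have "b i < a j"
      using ab(2)[OF that(1)] that(3) by auto
    moreover have "\<sigma> \<le> \<bar>b i - a j\<bar>"
      using that ab[OF that(1)] ab[OF that(2)] ne by (intro \<sigma>_dist) auto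
    ultimately show ?thesis
      by linarith
  qed
  \<comment> \<open>The indexing need not follow the line; distinct left endpoints supply the
    order.\<close>
  have inj: "inj_on a {1..s}"
  proof (rule inj_onI, rule ccontr)
    fix i j assume "i \<in> {1..s}" "j \<in> {1..s}" "a i = a j" "i \<noteq> j"
    then show False
      using disj[of i j] ab[of i] ab[of j] by auto
  qed
  have D: "D > 0"
  proof -
    have "a 1 \<noteq> a 2"
      using inj one by (metis inj_onD numeral_eq_one_iff semiring_norm(85))
    then show ?thesis
      using dist_le[of "a 1" "a 2"] inK one by fastforce
  qed
  have \<sigma>D: "\<sigma> \<le> D"
    using \<sigma>_dist[of 1 2 "a 1" "a 2"] dist_le[of "a 1" "a 2"] inK one ab by fastforce

  have fI: "f x = y i" if "i \<in> {1..s}" "x \<in> I i" for i x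
  proof -
    have "f x = (\<Sum>j\<in>{1..s}. if j = i then y j else 0)"
      unfolding f_def using disj that by (intro sum.cong) (auto simp: indicator_def)
    then show ?thesis
      using that by simp
  qed
  have y1: "\<bar>y i\<bar> \<le> 1" if "i \<in> {1..s}" for i
    using y that by (auto simp: Pi_iff abs_le_iff)
  have f1: "\<bar>f x\<bar> \<le> 1" if "x \<in> K" for x
    using that fI y1 by (auto simp: K_def segment_union_def)
  have bdd: "bounded (f ` K)"
    using f1 by (auto simp: bounded_iff)
  define M where "M = sup_norm_on K f"
  have yM: "\<bar>y i\<bar> \<le> M" if "i \<in> {1..s}" for i
  proof -
    have "\<bar>f (a i)\<bar> \<le> M"
      unfolding M_def sup_norm_on_def using f1 inK that by (intro cSUP_upper bdd_aboveI2[of _ _ 1])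
    then show ?thesis
      using fI[OF that, of "a i"] ab[OF that] by simp
  qed
  have M0: "0 \<le> M"
    using yM[of 1] one by simp

  \<comment> \<open>Half a gap after rescaling by D. The rate 1/15 in n\<delta> thus becomes 1/30 in
    n\<sigma>/D.\<close>
  define \<delta> where "\<delta> = \<sigma> / (2 * D)"
  define \<epsilon> where "\<epsilon> = exp (- (real n * \<delta>) / 15) / 2"
  have \<epsilon>: "2 * exp (- (real n * \<sigma> / D) / 30) = 4 * \<epsilon>"
    using D by (simp add: \<epsilon>_def \<delta>_def field_simps)
  have "constrained_approx_error n K f \<le> 4 * \<epsilon>"
  proof (cases "real n * \<delta> < 10")
    \<comment> \<open>Here the claimed bound is at least 1, because exp (-2/3) \<ge> 1/2, and the
      zero polynomial suffices.\<close>
    case True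
    have "exp (ln (1 / 2)) \<le> exp (- (real n * \<delta>) / 15)"
      unfolding exp_le_cancel_iff using True ln2_ge_two_thirds by (simp add: ln_div)
    then have "1 \<le> 4 * \<epsilon>"
      by (simp add: \<epsilon>_def)
    then show ?thesis
      using compact nonempty bdd M0 order.trans[OF f1]
      by (intro constrained_approx_error_le[of _ _ 0]) (auto simp: M_def)
  next
    case False
    \<comment> \<open>Positivity is read off from n\<delta> \<ge> 10, without a compactness
      argument.\<close>
    have \<sigma>0: "\<sigma> > 0"
      using False D mult_nonneg_nonpos[of "real n" \<delta>] divide_nonpos_pos[of \<sigma> "2 * D"]
      unfolding \<delta>_def by (smt (verit) of_nat_0_le_iff)
    obtain S :: "real poly" where S: "degree S \<le> n"
      "mono_on {-1..1} (poly S)" "poly S (-1) = 0" "poly S 1 = 1"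
      "poly S (-\<delta>) \<le> \<epsilon>" "1 - \<epsilon> \<le> poly S \<delta>"
      by (rule exponential_step_polynomial[of \<delta> n])
        (use \<sigma>0 \<sigma>D D False in \<open>auto simp: \<delta>_def \<epsilon>_def\<close>)
    have \<delta>: "0 < \<delta>" "\<delta> \<le> 1 / 2" "\<delta> * D = \<sigma> / 2"
      using \<sigma>0 \<sigma>D D by (auto simp: \<delta>_def)
    have monoS: "poly S u \<le> poly S v" if "-1 \<le> u" "u \<le> v" "v \<le> 1" for u v
      using mono_onD[OF S(2), of u v] that by simp
    have S01: "0 \<le> poly S u" "poly S u \<le> 1" if "-1 \<le> u" "u \<le> 1" for u
      using monoS[of "-1" u] monoS[of u 1] that S(3,4) by auto
    \<comment> \<open>A step at \<open>c\<close>. For x and \<open>c\<close> in [A, B] the rescaled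
      argument stays in [-1, 1], since B - A \<le> D.\<close>
    define T where "T c = pcompose S [:- c / D, 1 / D:]" for c
    have T: "poly (T c) x = poly S ((x - c) / D)" for c x
      by (simp add: T_def poly_pcompose diff_divide_distrib)
    have degT: "degree (T c) \<le> n" for c
      using S(1) D by (simp add: T_def degree_pcompose)
    define hasl where "hasl i \<longleftrightarrow> (\<exists>j\<in>{1..s}. a j < a i)" for i
    define hasr where "hasr i \<longleftrightarrow> (\<exists>j\<in>{1..s}. a i < a j)" for i
    (* An outermost segment has no jump on its outer side: it could lie outside the hull. *)
    define L where "L i = (if hasl i then T (a i - \<sigma> / 2) else 1)" for i
    define R where "R i = (if hasr i then T (b i + \<sigma> / 2) else 0)" for i
    define P where "P = (\<Sum>i\<in>{1..s}. smult (y i) (L i - R i))"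
    have degP: "degree P \<le> n"
      unfolding P_def L_def R_def using degT
      by (intro degree_sum_le order.trans[OF degree_smult_le] degree_diff_le) auto

    have cl: "A \<le> a i - \<sigma> / 2 \<and> a i - \<sigma> / 2 \<le> B" if "i \<in> {1..s}" and h: "hasl i" for i
    proof -
      obtain j where "j \<in> {1..s}" "a j < a i"
        using h unfolding hasl_def by blast
      then have "b j + \<sigma> \<le> a i" "A \<le> b j" "a i \<le> B"
        using gap that A(2) B(2) inK by auto
      then show ?thesis
        using \<sigma>0 by auto
    qed
    have cr: "A \<le> b i + \<sigma> / 2 \<and> b i + \<sigma> / 2 \<le> B" if "i \<in> {1..s}" and h: "hasr i" for i
    proof -
      obtain j where "j \<in> {1..s}" "a i < a j"
        using h unfolding hasr_def by blast
      then have "b i + \<sigma> \<le> a j" "a j \<le> B" "A \<le> b i"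
        using gap that A(2) B(2) inK by auto
      then show ?thesis
        using \<sigma>0 by auto
    qed
    have arg: "-1 \<le> (x - c) / D \<and> (x - c) / D \<le> 1" if "x \<in> {A..B}" "A \<le> c \<and> c \<le> B" for x c
      using that AB D by (auto simp: field_simps)
    have T01: "0 \<le> poly (T c) x \<and> poly (T c) x \<le> 1" if "x \<in> {A..B}" "A \<le> c \<and> c \<le> B" for x c
      using S01 arg[OF that] by (simp add: T)
    have Tmono: "poly (T d) x \<le> poly (T c) x"
      if "x \<in> {A..B}" "A \<le> c \<and> c \<le> B" "A \<le> d \<and> d \<le> B" "c \<le> d" for x c d
      unfolding T using arg[OF that(1,2)] arg[OF that(1,3)] that(4) D
      by (intro monoS) (auto simp: divide_right_mono)
    have L01: "0 \<le> poly (L i) x \<and> poly (L i) x \<le> 1" if "i \<in> {1..s}" "x \<in> {A..B}" for i x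
      using T01[OF that(2) cl[OF that(1)]] by (auto simp: L_def)
    have R01: "0 \<le> poly (R i) x \<and> poly (R i) x \<le> 1" if "i \<in> {1..s}" "x \<in> {A..B}" for i x
      using T01[OF that(2) cr[OF that(1)]] by (auto simp: R_def)
    have w0: "0 \<le> poly (L i) x - poly (R i) x" if i: "i \<in> {1..s}" and x: "x \<in> {A..B}" for i x
    proof (cases "hasl i \<and> hasr i")
      case True
      then show ?thesis
        using Tmono[OF x cl[OF i] cr[OF i]] ab(1)[OF i] \<sigma>0 by (simp add: L_def R_def)
    next
      case False
      then show ?thesis
        using L01[OF i x] R01[OF i x] by (auto simp: L_def R_def)
    qed
    have wsum: "(\<Sum>i\<in>{1..s}. poly (L i) x - poly (R i) x) \<le> 1" if x: "x \<in> {A..B}" for x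
    proof -
      have "(\<Sum>i\<in>{1..s}. poly (L i) x - poly (R i) x) \<le> 1 - 0"
      proof (rule sum_disjoint_increments_le[OF _ inj])
        fix i j assume ij: "i \<in> {1..s}" "j \<in> {1..s}" "a i < a j"
        then have "hasr i" "hasl j"
          by (auto simp: hasl_def hasr_def)
        then show "poly (L j) x \<le> poly (R i) x"
          \<comment> \<open>The gap leaves room for two half-gaps, so the downward jump of segment i
            does not come after the upward jump of segment j.\<close>
          using Tmono[OF x cr[OF ij(1)] cl[OF ij(2)]] gap[OF ij] by (simp add: L_def R_def)
      qed (use L01 R01 x in auto)
      then show ?thesis
        by simp
    qed
    have P: "poly P x = (\<Sum>i\<in>{1..s}. y i * (poly (L i) x - poly (R i) x))" for x
      by (simp add: P_def poly_sum)
    show ?thesis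
    proof (rule constrained_approx_error_le[OF compact nonempty bdd degP])
      fix x assume "x \<in> convex hull K"
      then have x: "x \<in> {A..B}"
        using hull by blast
      \<comment> \<open>Nonnegative weights of total at most 1 keep the values of P within M on the
        whole hull.\<close>
      have "\<bar>poly P x\<bar> \<le> (\<Sum>i\<in>{1..s}. \<bar>y i * (poly (L i) x - poly (R i) x)\<bar>)"
        unfolding P by (rule sum_abs)
      also have "\<dots> \<le> (\<Sum>i\<in>{1..s}. M * (poly (L i) x - poly (R i) x))"
        using w0 x yM unfolding abs_mult by (intro sum_mono mult_mono) (auto simp: M0)
      also have "\<dots> \<le> M * 1"
        unfolding sum_distrib_left[symmetric] using wsum[OF x] M0 by (intro mult_left_mono)
      finally show "\<bar>poly P x\<bar> \<le> sup_norm_on K f"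
        by (simp add: M_def)
    next
      fix x assume xK: "x \<in> K"
      then obtain i where i: "i \<in> {1..s}" "x \<in> I i"
        by (auto simp: K_def segment_union_def)
      have x: "x \<in> {A..B}"
        using A(2) B(2) xK by simp
      have xi: "a i \<le> x" "x \<le> b i"
        using i ab by auto
      define w where "w j = poly (L j) x - poly (R j) x" for j
      have "1 - \<epsilon> \<le> poly (L i) x"
      proof (cases "hasl i")
        case True
        \<comment> \<open>A point of the segment lies at least \<sigma>/2 = \<delta>D beyond the
          jump, where S is within \<epsilon> of its limit value.\<close>
        have "\<delta> \<le> (x - (a i - \<sigma> / 2)) / D"
          using xi D by (simp add: pos_le_divide_eq \<delta>)
        then have "poly S \<delta> \<le> poly (T (a i - \<sigma> / 2)) x"
          unfolding T using arg[OF x cl[OF i(1) True]] \<delta> by (intro monoS) auto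
        then show ?thesis
          using S(6) True by (simp add: L_def)
      qed (simp add: L_def \<epsilon>_def)
      moreover have "poly (R i) x \<le> \<epsilon>"
      proof (cases "hasr i")
        case True
        have "(x - (b i + \<sigma> / 2)) / D \<le> - \<delta>"
          using xi D by (simp add: pos_divide_le_eq \<delta>)
        then have "poly (T (b i + \<sigma> / 2)) x \<le> poly S (-\<delta>)"
          unfolding T using arg[OF x cr[OF i(1) True]] \<delta> by (intro monoS) auto
        then show ?thesis
          using S(5) True by (simp add: R_def)
      qed (simp add: R_def \<epsilon>_def)
      ultimately have wi: "1 - 2 * \<epsilon> \<le> w i"
        by (simp add: w_def)
      have wsum': "w i + (\<Sum>j\<in>{1..s} - {i}. w j) \<le> 1"
        using wsum[OF x] i(1) unfolding w_def by (subst (asm) sum.remove[of _ i]) auto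
      have w0': "0 \<le> w j" if "j \<in> {1..s}" for j
        using w0[OF that x] by (simp add: w_def)
      have rest0: "0 \<le> (\<Sum>j\<in>{1..s} - {i}. w j)"
        using w0' by (intro sum_nonneg) auto
      have "\<bar>\<Sum>j\<in>{1..s} - {i}. y j * w j\<bar> \<le> (\<Sum>j\<in>{1..s} - {i}. \<bar>y j * w j\<bar>)"
        by (rule sum_abs)
      also have "\<dots> \<le> (\<Sum>j\<in>{1..s} - {i}. w j)"
        using y1 w0' by (intro sum_mono) (auto simp: abs_mult mult_left_le_one_le)
      \<comment> \<open>All foreign weights together are at most 1 - w i \<le> 2 \<epsilon>, so the
        bound does not depend on s.\<close>
      finally have rest: "\<bar>\<Sum>j\<in>{1..s} - {i}. y j * w j\<bar> \<le> 2 * \<epsilon>"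
        using wsum' wi by linarith
      have "\<bar>y i * (1 - w i)\<bar> \<le> 1 * (2 * \<epsilon>)"
        unfolding abs_mult using y1[OF i(1)] wsum' rest0 wi by (intro mult_mono) auto
      moreover have "f x - poly P x = y i * (1 - w i) - (\<Sum>j\<in>{1..s} - {i}. y j * w j)"
        unfolding P w_def[symmetric] using i(1) fI[OF i]
        by (subst sum.remove[of _ i]) (auto simp: algebra_simps)
      ultimately show "\<bar>f x - poly P x\<bar> \<le> 4 * \<epsilon>"
        using rest by linarith
    qed
  qed
  then show ?thesis
    using \<epsilon> by (simp add: K_def f_def \<sigma>_def D_def)
qed

theorem theorem1:
  "(\<exists>c::real. c > 0 \<and>
      (\<forall>s I n. s \<ge> 2 \<longrightarrow> segment_system s I \<longrightarrow>
         segment_approx_error n s I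
           \<le> 2 * exp (- c * real n * min_gap s I / diameter (segment_union s I)))) \<and>
   (\<forall>s I n. s \<ge> 2 \<longrightarrow> segment_system s I \<longrightarrow>
      segment_approx_error n s I
        \<le> 2 * exp (- (1 / 30) * real n * min_gap s I / diameter (segment_union s I)))"
proof -
  have *: "\<forall>s I n. s \<ge> 2 \<longrightarrow> segment_system s I \<longrightarrow>
      segment_approx_error n s I
        \<le> 2 * exp (- (1 / 30) * real n * min_gap s I / diameter (segment_union s I))"
  proof (intro allI impI)
    fix s n :: nat and I :: "nat \<Rightarrow> real set"
    assume sI: "s \<ge> 2" "segment_system s I"
    \<comment> \<open>Witness that the supremum runs over a nonempty set.\<close>
    have "(\<lambda>_. 0) \<in> {1..s} \<rightarrow> {-1..1::real}"
      by simp
    then show "segment_approx_error n s I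
        \<le> 2 * exp (- (1 / 30) * real n * min_gap s I / diameter (segment_union s I))"
      unfolding segment_approx_error_def
      using constrained_approx_error_step_le[OF sI, of _ n]
      by (intro cSUP_least) (auto simp: mult.commute)
  qed
  then show ?thesis
    by (intro conjI exI[of _ "1 / 30"]) auto
qed

end
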